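(* Let $h(\xi)=\sum_{i=n}^ma_i\xi^i\in\mathbb{R}[\xi,\xi^{-1}]$ with $a_n,a_m\ne0$. For $k\in\mathbb{Z}$ define $$f_k(\xi)=\frac{h(\xi)\xi^k-h(\xi^{-1})\xi^{-k}}{\xi-\xi^{-1}}.$$ Let $d\theta$ denote the arclength measure on $S^1\subset\mathbb{C}^\times$ (total mass $2\pi$), and let $d\mu$ be the measure on $\mathbb{C}^\times$ supported on $S^1$ defined by $$d\mu=\frac{(\xi-\xi^{-1})(\xi^{-1}-\xi)}{h(\xi)h(\xi^{-1})}\,d\theta.$$ 1. If $\frac{h(\xi)}{h(\xi^{-1})}$ has no poles on the closed unit disk $\overline{\mathbb{D}}$, then the $f_k$ with $k\ge0$ are orthogonal on $\mathbb{C}^\times$ with respect to $d\mu$. If $\frac{h(\xi)}{h(\xi^{-1})}$ has no poles on $\hat{\mathbb{C}}\setminus\mathbb{D}$, then the $f_k$ with $k\le0$ are orthogonal with respect to $d\mu$. 2. If $h(\xi)=(1-a^{-1}\xi^{-1})(1+b^{-1}\xi^{-1})\xi$ with $1<a<\infty$ and $0<b<1$, then the $f_k$ with $k\ge0$ are orthogonal on $\mathbb{C}^\times$ with respect to the measure $$d\mu+\frac{4\pi(1-b^2)}{(1+a^{-1}b^{-1})(1+a^{-1}b)}\,\delta_{-b}.$$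
   Context: $\mathbb{D}$ is the open unit disk and $\hat{\mathbb{C}}$ the Riemann sphere. $\delta_{-b}$ is the Dirac mass at the point $-b\in\mathbb{C}^\times$. The functions $f_k$ are real-valued on $S^1$ and on $\mathbb{R}\setminus\{0\}$. A family $(f_k)_{k\in I}$ is orthogonal with respect to a measure $\rho$ if $\int f_kf_l\,d\rho=0$ for all $k\ne l$ in $I$. *)

theory Defs
  imports "HOL-Probability.Probability" "HOL-Complex_Analysis.Complex_Analysis"
begin

definition punctured_borel :: "complex measure" where
  "punctured_borel = restrict_space borel (- {0})"

definition arclength_circle :: "complex measure" where
  "arclength_circle = distr (restrict_space lborel {0..<2 * pi}) punctured_borel cis"

text \<open>The sum is only meaningful for two measures on the same sigma-algebra.\<close>

definition add_measure :: "'a measure \<Rightarrow> 'a measure \<Rightarrow> 'a measure" where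
  "add_measure M N = measure_of (space M) (sets M) (\<lambda>A. emeasure M A + emeasure N A)"

lemma space_add_measure [simp]: "space (add_measure M N) = space M"
  and sets_add_measure [simp, measurable_cong]: "sets (add_measure M N) = sets M"
  by (simp_all add: add_measure_def)

lemma emeasure_add_measure:
  assumes "sets N = sets M" "A \<in> sets M"
  shows "emeasure (add_measure M N) A = emeasure M A + emeasure N A"
proof -
  have "countably_additive (sets M) (\<lambda>A. emeasure M A + emeasure N A)"
  proof (rule countably_additiveI)
    fix F :: "nat \<Rightarrow> 'a set"
    assume F: "range F \<subseteq> sets M" "disjoint_family F" "(\<Union>i. F i) \<in> sets M"
    have "(\<Sum>i. emeasure M (F i) + emeasure N (F i))
        = (\<Sum>i. emeasure M (F i)) + (\<Sum>i. emeasure N (F i))"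
      by (rule suminf_add[symmetric]) auto
    also have "\<dots> = emeasure M (\<Union>i. F i) + emeasure N (\<Union>i. F i)"
      using F assms(1) by (simp add: suminf_emeasure)
    finally show "(\<Sum>i. emeasure M (F i) + emeasure N (F i))
        = emeasure M (\<Union>i. F i) + emeasure N (\<Union>i. F i)" .
  qed
  then show ?thesis
    unfolding add_measure_def
    by (intro emeasure_measure_of_sigma)
       (auto simp: positive_def assms(2) sets.sigma_algebra_axioms)
qed

lemma measurable_cis_punctured [measurable]: "cis \<in> borel \<rightarrow>\<^sub>M punctured_borel"
  unfolding punctured_borel_def
  by (rule measurable_restrict_space2) (auto intro!: borel_measurable_continuous_onI continuous_intros)

lemma emeasure_arclength_circle_total:
  "emeasure arclength_circle (space arclength_circle) = ennreal (2 * pi)"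
proof -
  have "cis \<in> restrict_space lborel {0..<2 * pi} \<rightarrow>\<^sub>M punctured_borel"
    by (intro measurable_restrict_space1) simp
  then have "emeasure arclength_circle (space arclength_circle)
      = emeasure (restrict_space lborel {0..<2 * pi}) (space (restrict_space lborel {0..<2 * pi}))"
    unfolding arclength_circle_def
    by (subst emeasure_distr) (auto simp: measurable_space intro!: arg_cong2[where f = emeasure])
  then show ?thesis
    by (simp add: emeasure_restrict_space space_restrict_space)
qed

text \<open>
  Division by zero gives the value 0 at \<open>\<xi> = 1\<close> and \<open>\<xi> = -1\<close>, where the Laurent polynomial
  \<open>f\<^sub>k\<close> need not vanish. Both points are null for the measures considered below.
\<close>

definition sym_quot :: "(complex \<Rightarrow> complex) \<Rightarrow> int \<Rightarrow> complex \<Rightarrow> complex" where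
  "sym_quot h k \<xi> =
     (h \<xi> * \<xi> powi k - h (inverse \<xi>) * \<xi> powi (- k)) / (\<xi> - inverse \<xi>)"

text \<open>
  For \<open>h\<close> with real coefficients the density is real and nonnegative on the unit circle
  (it is \<open>\<bar>\<xi> - \<xi>\<^sup>-\<^sup>1\<bar>\<^sup>2 / \<bar>h(\<xi>)\<bar>\<^sup>2\<close> there), so nothing is lost by \<open>Re\<close> and \<open>ennreal\<close>. The zeros of
  \<open>h\<close> on the circle form a null set.
\<close>

definition circle_weight :: "(complex \<Rightarrow> complex) \<Rightarrow> complex measure" where
  "circle_weight h = density arclength_circle
     (\<lambda>\<xi>. ennreal (Re ((\<xi> - inverse \<xi>) * (inverse \<xi> - \<xi>) / (h \<xi> * h (inverse \<xi>)))))"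

text \<open>
  The Bochner integral of a non-integrable function is 0 by convention, so integrability of the
  products has to be demanded explicitly. \<open>has_bochner_integral\<close> does so.
\<close>

definition orthogonal_family ::
    "'i set \<Rightarrow> ('i \<Rightarrow> complex \<Rightarrow> complex) \<Rightarrow> complex measure \<Rightarrow> bool" where
  "orthogonal_family I f \<rho> \<longleftrightarrow>
     (\<forall>k\<in>I. \<forall>l\<in>I. k \<noteq> l \<longrightarrow> has_bochner_integral \<rho> (\<lambda>\<xi>. f k \<xi> * f l \<xi>) 0)"

definition is_pole_at_infinity :: "(complex \<Rightarrow> complex) \<Rightarrow> bool" where
  "is_pole_at_infinity g \<longleftrightarrow> is_pole (\<lambda>w. g (inverse w)) 0"

end

theory Submission
  imports Defs
begin

text \<open>
  On the unit circle \<open>\<xi>\<^sup>-\<^sup>1\<close> is the conjugate of \<open>\<xi>\<close>, and since \<open>h\<close> has real coefficients \<open>h(\<xi>\<^sup>-\<^sup>1)\<close>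
  is the conjugate of \<open>h(\<xi>)\<close>. Put \<open>R(\<xi>) = h(\<xi>)/h(\<xi>\<^sup>-\<^sup>1)\<close>. Multiplying out \<open>f\<^sub>k f\<^sub>l\<close> and the weight, all
  denominators cancel except those in \<open>R\<close>, and what remains is
  \<open>\<xi>\<^sup>k\<^sup>-\<^sup>l + \<xi>\<^sup>l\<^sup>-\<^sup>k - R(\<xi>) \<xi>\<^sup>k\<^sup>+\<^sup>l\<close> minus the conjugate of \<open>R(\<xi>) \<xi>\<^sup>k\<^sup>+\<^sup>l\<close>
  (\<open>sym_quot_product_on_circle\<close>). For \<open>k \<noteq> l\<close> the first two powers integrate to zero, so the integral
  of \<open>f\<^sub>k f\<^sub>l\<close> is \<open>-4\<pi> Re A\<close>, where \<open>A\<close> is the mean value of \<open>R(\<xi>) \<xi>\<^sup>k\<^sup>+\<^sup>l\<close> over the circle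
  (\<open>has_bochner_integral_sym_quot_product\<close>).

  If \<open>R\<close> has no poles in the closed disc, then \<open>A\<close> is the value at \<open>0\<close> of the holomorphic extension of
  \<open>R(z) z\<^sup>k\<^sup>+\<^sup>l\<close>, which vanishes for distinct \<open>k, l \<ge> 0\<close> because \<open>k + l > 0\<close>. The exterior case is the
  interior case for \<open>h(\<xi>\<^sup>-\<^sup>1)\<close>: this exchange keeps the measure, inverts \<open>R\<close> and maps \<open>f\<^sub>k\<close> to
  \<open>-f\<^sub>-\<^sub>k\<close>.

  For \<open>h(\<xi>) = (1 - a\<^sup>-\<^sup>1\<xi>\<^sup>-\<^sup>1) (1 + b\<^sup>-\<^sup>1\<xi>\<^sup>-\<^sup>1) \<xi>\<close> the only pole of \<open>R\<close> in the disc is \<open>-b\<close>, and \<open>A\<close> is the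
  residue of \<open>R(z) z\<^sup>k\<^sup>+\<^sup>l\<^sup>-\<^sup>1\<close> there. As \<open>h(\<xi>\<^sup>-\<^sup>1)\<close> vanishes at \<open>-b\<close>, one has
  \<open>f\<^sub>k(-b) = (1 + a\<^sup>-\<^sup>1b\<^sup>-\<^sup>1) (-b)\<^sup>k\<close>, so the point mass contributes a multiple of \<open>(-b)\<^sup>k\<^sup>+\<^sup>l\<close>, as the
  residue does. The given mass is the one for which the two contributions cancel
  (\<open>orthogonal_with_point_mass\<close>).
\<close>

section \<open>Integration against sums, multiples and point masses\<close>

lemma nn_integral_add_measure:
  assumes sets: "sets N = sets M" and "f \<in> borel_measurable M"
  shows "nn_integral (add_measure M N) f = nn_integral M f + nn_integral N f"
proof -
  have N: "g \<in> borel_measurable N" if "g \<in> borel_measurable M" for g :: "'a \<Rightarrow> ennreal"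
    using that measurable_cong_sets[OF sets refl] by blast
  have L: "g \<in> borel_measurable (add_measure M N)" if "g \<in> borel_measurable M" for g :: "'a \<Rightarrow> ennreal"
    using that measurable_cong_sets[OF sets_add_measure refl] by blast
  show ?thesis
    using assms(2)
  proof (induction rule: borel_measurable_induct)
    case (cong f g)
    have "nn_integral K f = nn_integral K g" if "space K = space M" for K
      using cong.hyps(3) that by (intro nn_integral_cong) simp
    with cong.IH sets_eq_imp_space_eq[OF sets] show ?case by simp
  next
    case (set A)
    then show ?case using sets by (simp add: emeasure_add_measure)
  next
    case (mult u c)
    then show ?case by (simp add: N nn_integral_cmult distrib_left)
  next
    case (add u v)
    then show ?case by (simp add: N nn_integral_add ac_simps)
  next
    case (seq U)
    have SUP: "nn_integral K (\<Squnion> (range U)) = (SUP i. nn_integral K (U i))"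
      if "\<And>i. U i \<in> borel_measurable K" for K
    proof -
      have "\<Squnion> (range U) = (\<lambda>x. SUP i. U i x)" by (simp add: fun_eq_iff image_comp)
      then show ?thesis
        using nn_integral_monotone_convergence_SUP[OF \<open>incseq U\<close> that] by simp
    qed
    have inc: "incseq (\<lambda>i. nn_integral K (U i))" for K
      using \<open>incseq U\<close> by (auto simp: incseq_def le_fun_def intro!: nn_integral_mono)
    have "nn_integral (add_measure M N) (\<Squnion> (range U))
        = (SUP i. nn_integral M (U i) + nn_integral N (U i))"
      using SUP[OF L[OF seq.hyps(1)]] by (simp only: seq.IH)
    also have "\<dots> = nn_integral M (\<Squnion> (range U)) + nn_integral N (\<Squnion> (range U))"
      unfolding SUP[OF seq.hyps(1)] SUP[OF N[OF seq.hyps(1)]] by (rule ennreal_SUP_add[OF inc inc])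
    finally show ?case .
  qed
qed

lemma integral_indicator_scaleR:
  fixes c :: "'b::{banach, second_countable_topology}"
  assumes "A \<in> sets M" "emeasure M A < \<infinity>"
  shows "(\<integral>x. indicator A x *\<^sub>R c \<partial>M) = measure M A *\<^sub>R c"
  using has_bochner_integral_indicator[OF assms] by (rule has_bochner_integral_integral_eq)

text \<open>
  Both integrals are continuous under dominated convergence and agree on indicator functions;
  integrability transfers because the nonnegative integrals of the norm add.
\<close>

lemma has_bochner_integral_add_measure:
  fixes f :: "'a \<Rightarrow> 'b::{banach, second_countable_topology}"
  assumes sets: "sets N = sets M"
    and M: "has_bochner_integral M f x" and N: "has_bochner_integral N f y"
  shows "has_bochner_integral (add_measure M N) f (x + y)"
proof -
  let ?L = "add_measure M N"
  have meas: "borel_measurable ?L = borel_measurable M" "borel_measurable N = borel_measurable M"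
    using measurable_cong_sets[OF sets_add_measure refl] measurable_cong_sets[OF sets refl] by blast+
  have space: "space N = space M" using sets by (rule sets_eq_imp_space_eq)
  have int_iff: "integrable ?L g \<longleftrightarrow> integrable M g \<and> integrable N g" for g :: "'a \<Rightarrow> 'b"
  proof (cases "g \<in> borel_measurable M")
    case True
    then have "(\<lambda>x. ennreal (norm (g x))) \<in> borel_measurable M" by measurable
    from nn_integral_add_measure[OF sets this] True show ?thesis
      by (simp add: integrable_iff_bounded meas)
  qed (simp add: integrable_iff_bounded meas)
  have "integral\<^sup>L ?L g = integral\<^sup>L M g + integral\<^sup>L N g" if "integrable ?L g" for g :: "'a \<Rightarrow> 'b"
    using that
  proof (induction rule: integrable_induct)
    case (base A c)
    then have A: "A \<in> sets M" "A \<in> sets N" "emeasure M A < \<infinity>" "emeasure N A < \<infinity>"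
      using sets by (simp_all add: emeasure_add_measure)
    then have "measure ?L A = measure M A + measure N A"
      by (simp add: measure_def emeasure_add_measure[OF sets] enn2real_plus)
    then show ?case
      using integral_indicator_scaleR[OF base, of c] integral_indicator_scaleR[OF A(1,3), of c]
        integral_indicator_scaleR[OF A(2,4), of c]
      by (simp add: scaleR_add_left)
  next
    case (add f g)
    then show ?case by (simp add: int_iff)
  next
    case (lim f s)
    have conv: "(\<lambda>i. integral\<^sup>L K (s i)) \<longlonglongrightarrow> integral\<^sup>L K f"
      if K: "integrable K f" "\<And>i. integrable K (s i)" "space K = space ?L" for K
    proof (rule integral_dominated_convergence[where w = "\<lambda>x. 2 * norm (f x)"])
      show "f \<in> borel_measurable K" "\<And>i. s i \<in> borel_measurable K" "integrable K (\<lambda>x. 2 * norm (f x))"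
        using K(1,2) by simp_all
      show "AE x in K. (\<lambda>i. s i x) \<longlonglongrightarrow> f x"
        using lim.hyps(2) K(3) by (intro AE_I2) simp
      show "AE x in K. norm (s i x) \<le> 2 * norm (f x)" for i
        using lim.hyps(3) K(3) by (intro AE_I2) simp
    qed
    have "(\<lambda>i. integral\<^sup>L M (s i) + integral\<^sup>L N (s i)) \<longlonglongrightarrow> integral\<^sup>L M f + integral\<^sup>L N f"
      using lim.hyps(1,4) space by (intro tendsto_add conv) (simp_all add: int_iff)
    moreover have "(\<lambda>i. integral\<^sup>L ?L (s i)) \<longlonglongrightarrow> integral\<^sup>L ?L f"
      using lim.hyps(1,4) by (intro conv) simp_all
    ultimately show ?case unfolding lim.IH using LIMSEQ_unique by blast
  qed
  then show ?thesis using M N by (simp add: has_bochner_integral_iff int_iff)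
qed

lemma has_bochner_integral_return:
  fixes f :: "'a \<Rightarrow> 'b::{banach, second_countable_topology}"
  assumes f: "f \<in> borel_measurable M" and p: "p \<in> space M"
  shows "has_bochner_integral (return M p) f (f p)"
  unfolding has_bochner_integral_iff
proof
  have "(\<integral>\<^sup>+x. ennreal (norm (f x)) \<partial>return M p) = ennreal (norm (f p))"
    using f p by (intro nn_integral_return) auto
  moreover have "f \<in> borel_measurable (return M p)" using f by simp
  ultimately show "integrable (return M p) f"
    unfolding integrable_iff_bounded by (simp only: ennreal_less_top infinity_ennreal_def)
qed (rule integral_return[OF p f])

text \<open>
  Lets the integration rules for densities apply to scaled measures.
\<close>

lemma scale_measure_eq_density: "scale_measure c M = density M (\<lambda>_. c)"
  by (rule measure_eqI) (simp_all add: emeasure_density_const)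

section \<open>Integration over the unit circle\<close>

text \<open>
  The integrand need only agree off finitely many points with a function that is continuous on the
  circle: the integrands below are undefined quotients at \<open>1\<close>, \<open>-1\<close> and the zeros of \<open>h\<close>.
  Continuity makes the Lebesgue integral over an angle interval coincide with the gauge integral
  \<open>I\<close>, which is the form in which contour integrals are available.
\<close>

lemma has_bochner_integral_arclength_circle:
  fixes f \<Phi> :: "complex \<Rightarrow> complex"
  assumes f: "f \<in> borel_measurable punctured_borel"
    and \<Phi>: "continuous_on (sphere 0 1) \<Phi>"
    and S: "finite S" "\<And>\<xi>. norm \<xi> = 1 \<Longrightarrow> \<xi> \<notin> S \<Longrightarrow> f \<xi> = \<Phi> \<xi>"
    and I: "((\<lambda>t. \<Phi> (cis t)) has_integral I) {0..2 * pi}"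
  shows "has_bochner_integral arclength_circle f I"
proof -
  have cis: "cis \<in> restrict_space lborel {0..<2 * pi} \<rightarrow>\<^sub>M punctured_borel"
    by (intro measurable_restrict_space1) simp
  have "continuous_on {0..2 * pi} (\<lambda>t. \<Phi> (cis t))"
    by (rule continuous_on_compose2[OF \<Phi>]) (auto intro!: continuous_intros)
  then have int: "set_integrable lborel {0..2 * pi} (\<lambda>t. \<Phi> (cis t))"
    unfolding set_integrable_def by (intro borel_integrable_compact) auto
  then have bochner: "has_bochner_integral lborel (\<lambda>t. indicator {0..2 * pi} t *\<^sub>R \<Phi> (cis t)) I"
    using set_borel_integral_eq_integral(2)[OF int] integral_unique[OF I]
    by (simp add: has_bochner_integral_iff set_integrable_def set_lebesgue_integral_def)
  define T where "T = {t \<in> {0..<2 * pi}. cis t \<in> S}"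
  have "Arg2pi (cis t) = t" if "t \<in> {0..<2 * pi}" for t
    by (rule Arg2pi_unique[of 1]) (use that in \<open>auto simp: cis_conv_exp\<close>)
  then have "inj_on cis {0..<2 * pi}"
    by (rule inj_on_inverseI)
  then have "finite T"
    using finite_vimage_IntI[OF S(1), of cis "{0..<2 * pi}"] unfolding T_def
    by (rule_tac finite_subset) auto
  then have "AE t in lborel. t \<notin> insert (2 * pi) T"
    by (intro AE_not_in finite_imp_null_set_lborel) simp
  then have "AE t in lborel. indicator {0..<2 * pi} t *\<^sub>R f (cis t) = indicator {0..2 * pi} t *\<^sub>R \<Phi> (cis t)"
    by eventually_elim (auto simp: T_def indicator_def S(2))
  moreover have "(\<lambda>t. f (cis t)) \<in> borel_measurable lborel"
    using f by measurable
  then have "(\<lambda>t. indicator {0..<2 * pi} t *\<^sub>R f (cis t)) \<in> borel_measurable lborel"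
    by measurable
  moreover have "(\<lambda>t. indicator {0..2 * pi} t *\<^sub>R \<Phi> (cis t)) \<in> borel_measurable lborel"
    using bochner by (rule borel_measurable_has_bochner_integral)
  ultimately have "has_bochner_integral lborel (\<lambda>t. indicator {0..<2 * pi} t *\<^sub>R f (cis t)) I"
    using bochner has_bochner_integral_cong_AE by blast
  then show ?thesis
    unfolding arclength_circle_def
    by (intro has_bochner_integral_distr f cis) (simp add: has_bochner_integral_restrict_space)
qed

text \<open>
  On the unit circle \<open>dz/z = \<i> d\<theta>\<close>.
\<close>

lemma has_integral_circlepath:
  fixes g :: "complex \<Rightarrow> complex" and A :: complex
  assumes "((\<lambda>z. g z / z) has_contour_integral 2 * pi * \<i> * A) (circlepath 0 1)"
  shows "((\<lambda>t. g (cis t)) has_integral 2 * pi * A) {0..2 * pi}"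
proof -
  have "((\<lambda>t. g (cis t) * \<i>) has_integral 2 * pi * \<i> * A) {0..2 * pi}"
    using assms by (simp add: circlepath_def has_contour_integral_part_circlepath_iff)
  from has_integral_mult_right[OF this, of "- \<i>"] show ?thesis
    by (simp only: mult.commute[of _ \<i>] mult.assoc) (simp add: mult.assoc)
qed

lemma has_integral_cis_powi:
  assumes "j \<noteq> (0::int)"
  shows "((\<lambda>t. cis t powi j) has_integral 0) {0..2 * pi}"
proof -
  define F where "F t = cis (of_int j * t) / (\<i> * of_int j)" for t
  have "(F has_vector_derivative cis t powi j) (at t within {0..2 * pi})" for t
    using assms unfolding F_def cis_conv_exp
    by (auto intro!: derivative_eq_intros has_vector_derivative_real_field
        simp: exp_power_int algebra_simps)
  then have "((\<lambda>t. cis t powi j) has_integral (F (2 * pi) - F 0)) {0..2 * pi}"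
    by (intro fundamental_theorem_of_calculus) auto
  moreover have "cis (of_int j * (2 * pi)) = 1"
    using cis_multiple_2pi[of "of_int j"] by (simp add: mult_ac)
  ultimately show ?thesis by (simp add: F_def)
qed

lemma inverse_eq_cnj_on_circle: "norm \<xi> = 1 \<Longrightarrow> inverse \<xi> = cnj \<xi>"
  using complex_norm_square[of \<xi>] by (intro inverse_unique) simp

lemma power_int_diff_one: "norm z = 1 \<Longrightarrow> z powi (j - 1) = z powi j / z" for z :: complex
  by (subst power_int_diff) auto

section \<open>Laurent polynomials with real coefficients\<close>

text \<open>
  The value at \<open>0\<close> is left open: a Laurent polynomial has no value there, and neither poles
  nor the measures on \<open>\<complex> - {0}\<close> see it.
\<close>

definition real_laurent_polynomial :: "(complex \<Rightarrow> complex) \<Rightarrow> bool" where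
  "real_laurent_polynomial h \<longleftrightarrow> (\<exists>n m (c :: int \<Rightarrow> real). n \<le> m \<and> c n \<noteq> 0 \<and> c m \<noteq> 0 \<and>
     (\<forall>\<xi>. \<xi> \<noteq> 0 \<longrightarrow> h \<xi> = (\<Sum>i=n..m. of_real (c i) * \<xi> powi i)))"

text \<open>
  The class is stable under \<open>\<xi> \<mapsto> \<xi>\<^sup>-\<^sup>1\<close>, so every fact about \<open>h(\<xi>)\<close> also covers \<open>h(\<xi>\<^sup>-\<^sup>1)\<close>.
\<close>

lemma real_laurent_polynomial_reversal:
  assumes "real_laurent_polynomial h"
  shows "real_laurent_polynomial (\<lambda>\<xi>. h (inverse \<xi>))"
proof -
  obtain n m and c :: "int \<Rightarrow> real" where *: "n \<le> m" "c n \<noteq> 0" "c m \<noteq> 0"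
    "\<And>\<xi>. \<xi> \<noteq> 0 \<Longrightarrow> h \<xi> = (\<Sum>i=n..m. of_real (c i) * \<xi> powi i)"
    using assms unfolding real_laurent_polynomial_def by blast
  have "(\<Sum>i=n..m. of_real (c i) * inverse \<xi> powi i)
      = (\<Sum>i=-m..-n. of_real (c (- i)) * \<xi> powi i)" for \<xi> :: complex
    by (rule sum.reindex_bij_witness[of _ uminus uminus])
       (auto simp: power_int_minus power_int_inverse)
  with * show ?thesis
    unfolding real_laurent_polynomial_def
    by (intro exI[of _ "- m"] exI[of _ "- n"] exI[of _ "\<lambda>i. c (- i)"]) auto
qed

text \<open>
  Here the coefficients being real enters: on the circle inversion is conjugation.
\<close>

lemma real_laurent_polynomial_cnj:
  assumes "real_laurent_polynomial h" "norm \<xi> = 1"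
  shows "h (inverse \<xi>) = cnj (h \<xi>)"
proof -
  have "\<xi> \<noteq> 0" "inverse \<xi> = cnj \<xi>"
    using assms(2) inverse_eq_cnj_on_circle by auto
  with assms(1) show ?thesis
    unfolding real_laurent_polynomial_def by (auto simp: cnj_sum)
qed

lemma real_laurent_polynomial_measurable:
  assumes "real_laurent_polynomial h"
  shows "h \<in> borel_measurable punctured_borel"
proof -
  obtain n m and c :: "int \<Rightarrow> real" where 
    *: "\<And>\<xi>. \<xi> \<noteq> 0 \<Longrightarrow> h \<xi> = (\<Sum>i=n..m. of_real (c i) * \<xi> powi i)"
    using assms unfolding real_laurent_polynomial_def by blast
  have "continuous_on (- {0}) h"
    by (rule continuous_on_eq[of _ "\<lambda>\<xi>. \<Sum>i=n..m. of_real (c i) * \<xi> powi i"])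
       (auto intro!: continuous_intros simp: *)
  then show ?thesis
    unfolding punctured_borel_def by (rule borel_measurable_continuous_on_restrict)
qed

text \<open>
  Multiplying by \<open>\<xi>\<^sup>-\<^sup>n\<close> leaves a polynomial with constant coefficient \<open>c\<^sub>n \<noteq> 0\<close>.
\<close>

lemma real_laurent_polynomial_finite_zeros:
  assumes "real_laurent_polynomial h"
  shows "finite {\<xi>. \<xi> \<noteq> 0 \<and> h \<xi> = 0}"
proof -
  obtain n m and c :: "int \<Rightarrow> real" where *: "n \<le> m" "c n \<noteq> 0"
    "\<And>\<xi>. \<xi> \<noteq> 0 \<Longrightarrow> h \<xi> = (\<Sum>i=n..m. of_real (c i) * \<xi> powi i)"
    using assms unfolding real_laurent_polynomial_def by blast
  define p :: "complex poly" where "p = (\<Sum>j\<le>nat (m - n). monom (of_real (c (n + int j))) j)"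
  have "coeff p 0 \<noteq> 0"
    using *(2) by (simp add: p_def coeff_sum)
  then have "finite {\<xi>. poly p \<xi> = 0}"
    by (intro poly_roots_finite) auto
  moreover have "h \<xi> = \<xi> powi n * poly p \<xi>" if "\<xi> \<noteq> 0" for \<xi>
  proof -
    have "h \<xi> = (\<Sum>i=n..m. of_real (c i) * \<xi> powi i)" using * that by simp
    also have "\<dots> = (\<Sum>j\<le>nat (m - n). of_real (c (n + int j)) * \<xi> powi (n + int j))"
      using *(1) by (intro sum.reindex_bij_witness[of _ "\<lambda>j. n + int j" "\<lambda>i. nat (i - n)"]) auto
    also have "\<dots> = \<xi> powi n * poly p \<xi>"
      using that by (simp add: p_def poly_sum poly_monom sum_distrib_left power_int_add mult_ac)
    finally show ?thesis .
  qed
  ultimately show ?thesis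
    by (rule_tac finite_subset) auto
qed

lemma real_laurent_polynomial_analytic:
  assumes "real_laurent_polynomial h"
  shows "h analytic_on - {0}"
proof -
  obtain n m and c :: "int \<Rightarrow> real" where
    *: "\<And>\<xi>. \<xi> \<noteq> 0 \<Longrightarrow> h \<xi> = (\<Sum>i=n..m. of_real (c i) * \<xi> powi i)"
    using assms unfolding real_laurent_polynomial_def by blast
  have "(\<lambda>\<xi>. \<Sum>i=n..m. of_real (c i) * \<xi> powi i) holomorphic_on - {0}"
    by (intro holomorphic_intros) auto
  then have "h holomorphic_on - {0}"
    by (rule holomorphic_transform) (simp add: *)
  then show ?thesis using analytic_on_open[of "- {0}" h] by (simp add: open_Compl)
qed

lemma real_laurent_polynomial_meromorphic:
  assumes "real_laurent_polynomial h"
  shows "h meromorphic_on UNIV"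
proof -
  obtain n m and c :: "int \<Rightarrow> real" where
    *: "\<And>\<xi>. \<xi> \<noteq> 0 \<Longrightarrow> h \<xi> = (\<Sum>i=n..m. of_real (c i) * \<xi> powi i)"
    using assms unfolding real_laurent_polynomial_def by blast
  have "(\<lambda>\<xi>. \<Sum>i=n..m. of_real (c i) * \<xi> powi i) meromorphic_on UNIV"
    by (intro meromorphic_intros)
  moreover have "\<forall>\<^sub>F \<xi> in at z. h \<xi> = (\<Sum>i=n..m. of_real (c i) * \<xi> powi i)" for z
    using eventually_neq_at_within[of 0 z UNIV] by eventually_elim (rule *)
  ultimately show ?thesis
    using meromorphic_on_cong[of UNIV h "\<lambda>\<xi>. \<Sum>i=n..m. of_real (c i) * \<xi> powi i" UNIV] by simp
qed

lemma measurable_powi_punctured: "(\<lambda>\<xi>. \<xi> powi j) \<in> borel_measurable punctured_borel"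
  unfolding punctured_borel_def
  by (intro borel_measurable_continuous_on_restrict continuous_intros) auto

lemma measurable_sym_quot:
  assumes "real_laurent_polynomial h"
  shows "sym_quot h k \<in> borel_measurable punctured_borel"
proof -
  note [measurable] = real_laurent_polynomial_measurable[OF assms] measurable_powi_punctured
    real_laurent_polynomial_measurable[OF real_laurent_polynomial_reversal[OF assms]]
  have [measurable]: "(\<lambda>\<xi>. \<xi>) \<in> borel_measurable punctured_borel"
    using measurable_powi_punctured[of 1] by simp
  show ?thesis unfolding sym_quot_def by measurable
qed

section \<open>Reduction of orthogonality to a contour integral\<close>

text \<open>
  The quotient is already real and nonnegative, so the integral against \<open>circle_weight\<close> may be
  computed with the complex expression in place of its real part.
\<close>

lemma circle_weight_eq:
  assumes "norm \<xi> = 1" and "h (inverse \<xi>) = cnj (h \<xi>)"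
  shows "(\<xi> - inverse \<xi>) * (inverse \<xi> - \<xi>) / (h \<xi> * h (inverse \<xi>))
       = of_real ((norm (\<xi> - inverse \<xi>))\<^sup>2 / (norm (h \<xi>))\<^sup>2)"
proof -
  have "(\<xi> - inverse \<xi>) * (inverse \<xi> - \<xi>) / (h \<xi> * h (inverse \<xi>))
      = (\<xi> - cnj \<xi>) * cnj (\<xi> - cnj \<xi>) / (h \<xi> * cnj (h \<xi>))"
    using assms(2) by (simp add: inverse_eq_cnj_on_circle assms(1))
  also have "\<dots> = of_real ((norm (\<xi> - cnj \<xi>))\<^sup>2 / (norm (h \<xi>))\<^sup>2)"
    by (simp only: complex_norm_square[symmetric] of_real_divide)
  finally show ?thesis by (simp only: inverse_eq_cnj_on_circle[OF assms(1)])
qed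

text \<open>
  The denominators \<open>\<xi> - \<xi>\<^sup>-\<^sup>1\<close> cancel against the numerator of the weight. Expanding
  \<open>(h \<xi>\<^sup>k - h\<^sup>* \<xi>\<^sup>-\<^sup>k) (h \<xi>\<^sup>l - h\<^sup>* \<xi>\<^sup>-\<^sup>l)\<close>, where \<open>h\<^sup>*\<close> is \<open>h(\<xi>\<^sup>-\<^sup>1)\<close>, and dividing by \<open>- h h\<^sup>*\<close>
  leaves two pure powers and two conjugate terms that contain \<open>h / h\<^sup>*\<close>.
\<close>

lemma sym_quot_product_on_circle:
  assumes "norm \<xi> = 1" "\<xi> \<noteq> 1" "\<xi> \<noteq> -1" and h: "h \<xi> \<noteq> 0" "h (inverse \<xi>) = cnj (h \<xi>)"
  shows "Re ((\<xi> - inverse \<xi>) * (inverse \<xi> - \<xi>) / (h \<xi> * h (inverse \<xi>)))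
           *\<^sub>R (sym_quot h k \<xi> * sym_quot h l \<xi>)
       = \<xi> powi (k - l) + \<xi> powi (l - k)
           - h \<xi> / h (inverse \<xi>) * \<xi> powi (k + l) - cnj (h \<xi> / h (inverse \<xi>) * \<xi> powi (k + l))"
    (is "Re ?w *\<^sub>R _ = _")
proof -
  have \<xi>: "\<xi> \<noteq> 0" "inverse \<xi> = cnj \<xi>"
    using assms(1) inverse_eq_cnj_on_circle by auto
  have d: "\<xi> - inverse \<xi> \<noteq> 0"
    using assms \<xi>(1) by (auto simp: field_simps power2_eq_square[symmetric] power2_eq_1_iff)
  have K: "cnj (h \<xi>) \<noteq> 0" using h by simp
  have ab: "\<xi> powi k \<noteq> 0" "\<xi> powi l \<noteq> 0" using \<xi> by auto
  have R: "Re ?w *\<^sub>R z = ?w * z" for z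
    unfolding circle_weight_eq[OF assms(1) h(2)] by (simp add: scaleR_conv_of_real)
  have alg: "d * e / (H * K) * ((H * a - K * inverse a) / d * ((H * b - K * inverse b) / d))
      = a / b + b / a - H / K * (a * b) - K / H * (inverse a * inverse b)"
    if "d \<noteq> 0" "H \<noteq> 0" "K \<noteq> 0" "a \<noteq> 0" "b \<noteq> 0" "e = - d" for a b d e H K :: complex
    using that by (simp add: field_simps)
  have "cnj (\<xi> powi (k + l)) = inverse (\<xi> powi k) * inverse (\<xi> powi l)"
    using \<xi> by (simp add: power_int_add flip: \<xi>(2) power_int_inverse)
  then have rhs: "\<xi> powi (k - l) + \<xi> powi (l - k)
           - h \<xi> / h (inverse \<xi>) * \<xi> powi (k + l) - cnj (h \<xi> / h (inverse \<xi>) * \<xi> powi (k + l))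
      = \<xi> powi k / \<xi> powi l + \<xi> powi l / \<xi> powi k - h \<xi> / cnj (h \<xi>) * (\<xi> powi k * \<xi> powi l)
           - cnj (h \<xi>) / h \<xi> * (inverse (\<xi> powi k) * inverse (\<xi> powi l))"
    using \<xi>(1) by (simp add: h(2) power_int_diff power_int_add)
  show "Re ?w *\<^sub>R (sym_quot h k \<xi> * sym_quot h l \<xi>)
       = \<xi> powi (k - l) + \<xi> powi (l - k)
           - h \<xi> / h (inverse \<xi>) * \<xi> powi (k + l) - cnj (h \<xi> / h (inverse \<xi>) * \<xi> powi (k + l))"
    unfolding rhs unfolding R unfolding sym_quot_def h(2) power_int_minus
    by (rule alg[OF d h(1) K ab]) simp
qed

text \<open>
  The pure powers \<open>\<xi>\<^sup>k\<^sup>-\<^sup>l\<close> and \<open>\<xi>\<^sup>l\<^sup>-\<^sup>k\<close> integrate to \<open>0\<close>, and the two conjugate terms contribute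
  \<open>- 2\<pi>A\<close> and its conjugate. Passing to a continuous \<open>G\<close> is harmless because the zeros of \<open>h\<close>
  form a null set, and it makes Cauchy's theorem applicable.
\<close>

lemma has_bochner_integral_sym_quot_product:
  assumes h: "real_laurent_polynomial h" and kl: "k \<noteq> l"
    and G: "continuous_on (sphere 0 1) G"
      "\<And>\<xi>. norm \<xi> = 1 \<Longrightarrow> h \<xi> \<noteq> 0 \<Longrightarrow> G \<xi> = h \<xi> / h (inverse \<xi>)"
    and A: "((\<lambda>z. G z * z powi (k + l - 1)) has_contour_integral 2 * pi * \<i> * A) (circlepath 0 1)"
  shows "has_bochner_integral (circle_weight h) (\<lambda>\<xi>. sym_quot h k \<xi> * sym_quot h l \<xi>)
           (- complex_of_real (4 * pi * Re A))"
proof -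
  let ?w = "\<lambda>\<xi>. Re ((\<xi> - inverse \<xi>) * (inverse \<xi> - \<xi>) / (h \<xi> * h (inverse \<xi>)))"
  let ?f = "\<lambda>\<xi>. sym_quot h k \<xi> * sym_quot h l \<xi>"
  define \<Phi> where "\<Phi> \<xi> = \<xi> powi (k - l) + \<xi> powi (l - k)
      - G \<xi> * \<xi> powi (k + l) - cnj (G \<xi> * \<xi> powi (k + l))" for \<xi>
  note [measurable] = real_laurent_polynomial_measurable[OF h]
    real_laurent_polynomial_measurable[OF real_laurent_polynomial_reversal[OF h]]
    measurable_sym_quot[OF h]
  have [measurable]: "(\<lambda>\<xi>. \<xi>) \<in> borel_measurable punctured_borel"
    using measurable_powi_punctured[of 1] by simp
  have w: "?w \<in> borel_measurable punctured_borel" by measurable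
  have f: "?f \<in> borel_measurable punctured_borel" by measurable
  have arc: "sets arclength_circle = sets punctured_borel" by (simp add: arclength_circle_def)
  have w': "?w \<in> borel_measurable arclength_circle" and f': "?f \<in> borel_measurable arclength_circle"
    using w f measurable_cong_sets[OF arc refl] by blast+

  have "((\<lambda>z. G z * z powi (k + l) / z) has_contour_integral 2 * pi * \<i> * A) (circlepath 0 1)"
    using A by (rule has_contour_integral_eq) (auto simp: power_int_diff_one)
  then have "((\<lambda>t. G (cis t) * cis t powi (k + l)) has_integral 2 * pi * A) {0..2 * pi}"
    by (rule has_integral_circlepath)
  moreover from has_integral_linear[OF this bounded_linear_cnj]
  have "((\<lambda>t. cnj (G (cis t) * cis t powi (k + l))) has_integral cnj (2 * pi * A)) {0..2 * pi}"
    by (simp only: o_def)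
  moreover have "((\<lambda>t. cis t powi (k - l)) has_integral 0) {0..2 * pi}"
    "((\<lambda>t. cis t powi (l - k)) has_integral 0) {0..2 * pi}"
    using kl by (intro has_integral_cis_powi; simp)+
  ultimately have "((\<lambda>t. \<Phi> (cis t)) has_integral 0 + 0 - 2 * pi * A - cnj (2 * pi * A)) {0..2 * pi}"
    unfolding \<Phi>_def by (intro has_integral_add has_integral_diff)
  moreover have "0 + 0 - 2 * pi * A - cnj (2 * pi * A) = - complex_of_real (4 * pi * Re A)"
    by (simp add: complex_eq_iff)
  ultimately have int: "((\<lambda>t. \<Phi> (cis t)) has_integral - complex_of_real (4 * pi * Re A)) {0..2 * pi}"
    by (simp only:)

  have cont: "continuous_on (sphere 0 1) \<Phi>"
    unfolding \<Phi>_def by (intro continuous_intros G) auto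
  have fin: "finite ({1, -1} \<union> {\<xi>. \<xi> \<noteq> 0 \<and> h \<xi> = 0})"
    using real_laurent_polynomial_finite_zeros[OF h] by simp
  have eq: "?w \<xi> *\<^sub>R ?f \<xi> = \<Phi> \<xi>"
    if "norm \<xi> = 1" "\<xi> \<notin> {1, -1} \<union> {\<xi>. \<xi> \<noteq> 0 \<and> h \<xi> = 0}" for \<xi>
  proof -
    have "\<xi> \<noteq> 0" "\<xi> \<noteq> 1" "\<xi> \<noteq> -1" "h \<xi> \<noteq> 0" using that by auto
    then show ?thesis
      unfolding \<Phi>_def
      using sym_quot_product_on_circle[of \<xi> h k l] that(1)
        real_laurent_polynomial_cnj[OF h] G(2)[of \<xi>] by simp
  qed
  have "has_bochner_integral arclength_circle (\<lambda>\<xi>. ?w \<xi> *\<^sub>R ?f \<xi>) (- complex_of_real (4 * pi * Re A))"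
    by (rule has_bochner_integral_arclength_circle[OF borel_measurable_scaleR[OF w f] cont fin eq int])
  moreover have "AE \<xi> in arclength_circle. 0 \<le> ?w \<xi>"
    unfolding arclength_circle_def
  proof (subst AE_distr_iff)
    show "cis \<in> restrict_space lborel {0..<2 * pi} \<rightarrow>\<^sub>M punctured_borel"
      by (intro measurable_restrict_space1) simp
    show "{\<xi> \<in> space punctured_borel. 0 \<le> ?w \<xi>} \<in> sets punctured_borel"
      using w by measurable
    show "AE t in restrict_space lborel {0..<2 * pi}. 0 \<le> ?w (cis t)"
    proof (intro AE_I2)
      fix t :: real
      show "0 \<le> ?w (cis t)"
        using circle_weight_eq[of "cis t" h] real_laurent_polynomial_cnj[OF h, of "cis t"]
        by (simp only: norm_cis Re_complex_of_real) simp
    qed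
  qed
  ultimately show ?thesis
    unfolding circle_weight_def by (intro has_bochner_integral_density w' f')
qed

section \<open>The three orthogonality statements\<close>

text \<open>
  Removing the singularities of \<open>h(\<xi>)/h(\<xi>\<^sup>-\<^sup>1)\<close> gives a function \<open>G\<close> that is holomorphic on the
  closed disc, so \<open>G(z) z\<^sup>k\<^sup>+\<^sup>l\<close> has mean value \<open>0\<close> over the circle as soon as \<open>k + l > 0\<close>, hence for
  all distinct \<open>k, l \<ge> 0\<close>.
\<close>

lemma orthogonal_if_no_poles_in_disc:
  assumes h: "real_laurent_polynomial h"
    and poles: "\<forall>z\<in>cball 0 1. \<not> is_pole (\<lambda>\<xi>. h \<xi> / h (inverse \<xi>)) z"
  shows "orthogonal_family {0..} (sym_quot h) (circle_weight h)"
proof -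
  let ?R = "\<lambda>\<xi>. h \<xi> / h (inverse \<xi>)"
  define G where "G = remove_sings ?R"
  note h' = real_laurent_polynomial_reversal[OF h]
  have mero: "?R meromorphic_on UNIV"
    using h h' by (intro meromorphic_intros real_laurent_polynomial_meromorphic)
  have "G analytic_on cball 0 1"
    unfolding G_def analytic_on_analytic_at[of _ "cball 0 1"]
  proof
    fix z :: complex assume "z \<in> cball 0 1"
    have z: "?R meromorphic_on {z}"
      using mero by (rule meromorphic_on_subset) simp
    obtain c where "?R \<midarrow>z\<rightarrow> c"
      using meromorphic_on_not_essential[OF z] poles \<open>z \<in> cball 0 1\<close>
      unfolding not_essential_def by blast
    with meromorphic_on_isolated_singularity[OF z] show "remove_sings ?R analytic_on {z}"
      by (rule remove_sings_analytic_at)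
  qed
  then have G: "G holomorphic_on cball 0 1" by (rule analytic_imp_holomorphic)
  have GR: "G \<xi> = ?R \<xi>" if "norm \<xi> = 1" "h \<xi> \<noteq> 0" for \<xi>
  proof -
    have "\<xi> \<noteq> 0" using that by auto
    then have "h analytic_on {\<xi>}" "(\<lambda>\<xi>. h (inverse \<xi>)) analytic_on {\<xi>}"
      by (auto intro: analytic_on_subset[OF real_laurent_polynomial_analytic[OF h]]
          analytic_on_subset[OF real_laurent_polynomial_analytic[OF h']])
    then have "?R analytic_on {\<xi>}"
      using real_laurent_polynomial_cnj[OF h that(1)] that(2) by (intro analytic_on_divide) auto
    then show ?thesis unfolding G_def by simp
  qed
  have "has_bochner_integral (circle_weight h) (\<lambda>\<xi>. sym_quot h k \<xi> * sym_quot h l \<xi>) 0"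
    if "0 \<le> k" "0 \<le> l" "k \<noteq> l" for k l
  proof -
    have pos: "0 < nat (k + l)" and Suc: "nat (k + l) = Suc (nat (k + l - 1))" using that by simp_all
    have "(\<lambda>z. G z * z ^ nat (k + l)) holomorphic_on cball 0 1"
      by (intro holomorphic_intros G)
    \<comment> \<open>Cauchy's formula at \<open>0\<close>; the value there vanishes because \<open>k + l > 0\<close>.\<close>
    then have "((\<lambda>z. G z * z ^ nat (k + l) / (z - 0)) has_contour_integral
        2 * of_real pi * \<i> * (G 0 * 0 ^ nat (k + l))) (circlepath 0 1)"
      by (rule Cauchy_integral_circlepath_simple) simp
    then have "((\<lambda>z. G z * z powi (k + l - 1)) has_contour_integral
        2 * of_real pi * \<i> * (G 0 * 0 ^ nat (k + l))) (circlepath 0 1)"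
      by (rule has_contour_integral_eq) (use that in \<open>auto simp: Suc power_int_def\<close>)
    moreover have "2 * of_real pi * \<i> * (G 0 * 0 ^ nat (k + l)) = 2 * pi * \<i> * 0"
      using pos by simp
    moreover have "continuous_on (sphere 0 1) G"
      using G by (auto intro: holomorphic_on_imp_continuous_on continuous_on_subset)
    ultimately show ?thesis
      using has_bochner_integral_sym_quot_product[OF h that(3) _ GR, where A = 0] by simp
  qed
  then show ?thesis by (auto simp: orthogonal_family_def)
qed

text \<open>
  Together with the invariance of the measure, this turns the pole condition outside the disc into
  the one inside: replacing \<open>h(\<xi>)\<close> by \<open>h(\<xi>\<^sup>-\<^sup>1)\<close> exchanges the indices \<open>k\<close> and \<open>-k\<close> up to sign.
\<close>

lemma sym_quot_reversal: "sym_quot (\<lambda>\<xi>. h (inverse \<xi>)) (- k) \<xi> = - sym_quot h k \<xi>"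
  by (simp add: sym_quot_def minus_divide_left)

lemma circle_weight_reversal: "circle_weight (\<lambda>\<xi>. h (inverse \<xi>)) = circle_weight h"
  by (simp add: circle_weight_def mult.commute)

lemma orthogonal_if_no_poles_outside_disc:
  assumes h: "real_laurent_polynomial h"
    and poles: "\<forall>z\<in>- ball 0 1. \<not> is_pole (\<lambda>\<xi>. h \<xi> / h (inverse \<xi>)) z"
      "\<not> is_pole_at_infinity (\<lambda>\<xi>. h \<xi> / h (inverse \<xi>))"
  shows "orthogonal_family {..0} (sym_quot h) (circle_weight h)"
proof -
  let ?h' = "\<lambda>\<xi>. h (inverse \<xi>)"
  have "\<not> is_pole (\<lambda>\<xi>. ?h' \<xi> / ?h' (inverse \<xi>)) z" if "z \<in> cball 0 1" for z
  proof (cases "z = 0")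
    case True
    then show ?thesis using poles(2) by (simp add: is_pole_at_infinity_def)
  next
    case False
    have "is_pole (\<lambda>\<xi>. h \<xi> / h (inverse \<xi>)) (inverse z)"
      if "is_pole (\<lambda>\<xi>. ?h' \<xi> / ?h' (inverse \<xi>)) z"
    proof -
      have "inverse \<midarrow>inverse z\<rightarrow> z"
        using tendsto_inverse[OF tendsto_ident_at, of "inverse z" UNIV] False by simp
      moreover have "\<forall>\<^sub>F w in at (inverse z). inverse w \<noteq> z"
        using eventually_neq_at_within[of "inverse z" "inverse z" UNIV] by eventually_elim auto
      ultimately show ?thesis
        using is_pole_compose[OF that, of inverse "inverse z"] by simp
    qed
    moreover have "inverse z \<in> - ball 0 1"
      using one_le_inverse[of "norm z"] that False by (simp add: norm_inverse not_less)
    ultimately show ?thesis using poles(1) by blast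
  qed
  then have orth: "orthogonal_family {0..} (sym_quot ?h') (circle_weight ?h')"
    by (intro orthogonal_if_no_poles_in_disc real_laurent_polynomial_reversal h) blast
  show ?thesis
    unfolding orthogonal_family_def
  proof (intro ballI impI)
    fix k l :: int assume "k \<in> {..0}" "l \<in> {..0}" "k \<noteq> l"
    then have "has_bochner_integral (circle_weight ?h') (\<lambda>\<xi>. sym_quot ?h' (- k) \<xi> * sym_quot ?h' (- l) \<xi>) 0"
      using orth by (simp add: orthogonal_family_def)
    then show "has_bochner_integral (circle_weight h) (\<lambda>\<xi>. sym_quot h k \<xi> * sym_quot h l \<xi>) 0"
      unfolding sym_quot_reversal circle_weight_reversal by simp
  qed
qed

text \<open>
  Since \<open>h(\<xi>\<^sup>-\<^sup>1)\<close> vanishes at \<open>\<xi> = -b\<close>, only the first term of the numerator survives.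
\<close>

lemma sym_quot_at_interior_pole:
  fixes a b :: real
  assumes ab: "1 < a" "0 < b" "b < 1"
    and h: "\<And>\<xi>. \<xi> \<noteq> 0 \<Longrightarrow> h \<xi> =
      (1 - inverse (of_real a) * inverse \<xi>) * (1 + inverse (of_real b) * inverse \<xi>) * \<xi>"
  shows "sym_quot h k (- complex_of_real b) = of_real ((1 + inverse a * inverse b) * (- b) powi k)"
proof -
  let ?z = "- complex_of_real b"
  have z: "?z \<noteq> 0" "inverse ?z \<noteq> 0" using ab by auto
  have "b * b \<noteq> 1" using ab mult_strict_mono[of b 1 b 1] by auto
  have "h (inverse ?z) = 0"
    unfolding h[OF z(2)] using ab by simp
  moreover have "h ?z = of_real ((1 + inverse a * inverse b) * (- b + inverse b))"
    unfolding h[OF z(1)] using ab by (simp add: field_simps)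
  moreover have "?z - inverse ?z = of_real (- b + inverse b)" by simp
  moreover have "- b + inverse b \<noteq> 0"
    using ab \<open>b * b \<noteq> 1\<close> by (auto simp: field_simps)
  moreover have cancel: "of_real (c * t) * w / of_real t = of_real c * w" if "t \<noteq> 0"
    for c t :: real and w :: complex using that by simp
  ultimately have "sym_quot h k ?z = of_real ((1 + inverse a * inverse b) * (- b + inverse b)) * ?z powi k
      / of_real (- b + inverse b)"
    by (simp add: sym_quot_def)
  also have "\<dots> = of_real (1 + inverse a * inverse b) * ?z powi k"
    using \<open>- b + inverse b \<noteq> 0\<close> cancel by blast
  also have "?z powi k = of_real ((- b) powi k)" by simp
  finally show ?thesis by simp
qed

text \<open>
  Now \<open>h(\<xi>)/h(\<xi>\<^sup>-\<^sup>1)\<close> has poles at \<open>a\<close>, outside the disc, and at \<open>-b\<close>, inside. Cauchy's formula at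
  \<open>-b\<close> gives the defect of orthogonality on the circle. It is a multiple of \<open>(-b)\<^sup>k\<^sup>+\<^sup>l\<close>, and so is
  the product of the values at \<open>-b\<close>; a mass at that point can therefore cancel it for all
  \<open>k\<close> and \<open>l\<close> at once.
\<close>

lemma orthogonal_with_point_mass:
  fixes a b :: real
  assumes lp: "real_laurent_polynomial h"
    and ab: "1 < a" "0 < b" "b < 1"
    and h: "\<And>\<xi>. \<xi> \<noteq> 0 \<Longrightarrow> h \<xi> =
      (1 - inverse (of_real a) * inverse \<xi>) * (1 + inverse (of_real b) * inverse \<xi>) * \<xi>"
  defines "r \<equiv> 4 * pi * (1 - b\<^sup>2) / ((1 + inverse a * inverse b) * (1 + inverse a * b))"
  shows "orthogonal_family {0..} (sym_quot h)
    (add_measure (circle_weight h)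
      (scale_measure (ennreal r) (return punctured_borel (- complex_of_real b))))"
  unfolding orthogonal_family_def
proof (intro ballI impI)
  fix k l :: int assume kl: "k \<in> {0..}" "l \<in> {0..}" "k \<noteq> l"
  define N where "N = nat (k + l - 1)"
  \<comment> \<open>On the circle \<open>h(\<xi>)/h(\<xi>\<^sup>-\<^sup>1) = q(\<xi>)/(\<xi> + b)\<close>, where \<open>q\<close> is holomorphic on the closed disc.\<close>
  define q where "q z = (z - inverse (of_real a)) * (z + inverse (of_real b)) * of_real b
    / (1 - inverse (of_real a) * z)" for z :: complex
  \<comment> \<open>The residue of \<open>q(z) z\<^sup>N / (z + b)\<close> at \<open>-b\<close>.\<close>
  define A where "A = - (b + inverse a) * (1 - b\<^sup>2) / (1 + inverse a * b) * (- b) ^ N"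
  have den: "1 - inverse (of_real a) * z \<noteq> 0" if "norm z \<le> 1" for z :: complex
  proof
    assume "1 - inverse (of_real a) * z = 0"
    then have "norm (inverse (complex_of_real a) * z) = 1" by simp
    then have "norm z = a" using ab by (simp add: norm_mult norm_inverse norm_divide field_simps)
    then show False using that ab by simp
  qed
  have far: "z + of_real b \<noteq> 0" if "norm z = 1" for z :: complex
  proof
    assume "z + of_real b = 0"
    then have "z = - complex_of_real b" by (simp add: eq_neg_iff_add_eq_0)
    then have "norm z = b" using ab by simp
    then show False using that ab by simp
  qed
  have q: "q holomorphic_on cball 0 1"
    unfolding q_def using den by (intro holomorphic_intros) auto
  have Gcont: "continuous_on (sphere 0 1) (\<lambda>z. q z / (z + of_real b))"
    using far by (intro continuous_intros holomorphic_on_imp_continuous_on holomorphic_on_subset[OF q]) auto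
  have GR: "q \<xi> / (\<xi> + of_real b) = h \<xi> / h (inverse \<xi>)" if "norm \<xi> = 1" "h \<xi> \<noteq> 0" for \<xi>
  proof -
    have \<xi>: "\<xi> \<noteq> 0" "inverse \<xi> \<noteq> 0" using that by auto
    have "h \<xi> = (\<xi> - inverse (of_real a)) * (\<xi> + inverse (of_real b)) / \<xi>"
      unfolding h[OF \<xi>(1)] using \<xi>(1) by (simp add: divide_simps) (simp add: algebra_simps)
    moreover have "h (inverse \<xi>) = (1 - inverse (of_real a) * \<xi>) * (\<xi> + of_real b) / (of_real b * \<xi>)"
      unfolding h[OF \<xi>(2)] using \<xi>(1) ab by (simp add: divide_simps)
    moreover have "P * Q * of_real b / D / F = P * Q / \<xi> / (D * F / (of_real b * \<xi>))" for P Q D F :: complex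
      using \<xi>(1) ab by simp
    ultimately show ?thesis
      unfolding q_def by (simp only:)
  qed
  have qb: "q (- of_real b) * (- of_real b) ^ N = complex_of_real A"
  proof -
    have "q (- of_real b) = of_real ((- b - inverse a) * (- b + inverse b) * b / (1 + inverse a * b))"
      unfolding q_def by simp
    also have "(- b - inverse a) * (- b + inverse b) * b = - (b + inverse a) * (1 - b\<^sup>2)"
      using ab by (simp add: field_simps power2_eq_square)
    finally show ?thesis unfolding A_def by simp
  qed
  have "(\<lambda>z. q z * z ^ N) holomorphic_on cball 0 1"
    by (intro holomorphic_intros q)
  then have "((\<lambda>z. q z * z ^ N / (z - (- of_real b))) has_contour_integral
      2 * of_real pi * \<i> * (q (- of_real b) * (- of_real b) ^ N)) (circlepath 0 1)"
    by (rule Cauchy_integral_circlepath_simple) (use ab in simp)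
  then have "((\<lambda>z. q z / (z + of_real b) * z powi (k + l - 1)) has_contour_integral
      2 * pi * \<i> * complex_of_real A) (circlepath 0 1)"
    unfolding qb of_real_mult of_real_numeral
    by (rule has_contour_integral_eq) (use kl in \<open>auto simp: power_int_def N_def\<close>)
  then have circle: "has_bochner_integral (circle_weight h) (\<lambda>\<xi>. sym_quot h k \<xi> * sym_quot h l \<xi>)
      (- complex_of_real (4 * pi * A))"
    using has_bochner_integral_sym_quot_product[OF lp kl(3) Gcont GR, where A = "complex_of_real A"] by simp
  have "1 - b\<^sup>2 > 0" using ab by (simp add: power_less_one_iff abs_square_less_1)
  moreover have pos: "0 < 1 + inverse a * inverse b" "0 < 1 + inverse a * b"
    using ab by (auto intro!: add_pos_pos)
  ultimately have "0 \<le> r" unfolding r_def by simp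
  moreover have "- complex_of_real b \<in> space punctured_borel"
    using ab by (simp add: punctured_borel_def space_restrict_space)
  moreover note [measurable] = measurable_sym_quot[OF lp]
  have "(\<lambda>\<xi>. sym_quot h k \<xi> * sym_quot h l \<xi>) \<in> borel_measurable punctured_borel"
    by measurable
  ultimately have point: "has_bochner_integral (scale_measure (ennreal r) (return punctured_borel (- of_real b)))
      (\<lambda>\<xi>. sym_quot h k \<xi> * sym_quot h l \<xi>)
      (r *\<^sub>R (sym_quot h k (- of_real b) * sym_quot h l (- of_real b)))"
    unfolding scale_measure_eq_density
    by (intro has_bochner_integral_density has_bochner_integral_scaleR_right
          has_bochner_integral_return) simp_all
  have "(- b) powi k * (- b) powi l = (- b) powi (k + l)"
    using ab by (simp add: power_int_add)
  also have "\<dots> = (- b) * (- b) ^ N"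
  proof -
    have "nat (k + l) = Suc N" unfolding N_def using kl by simp
    then show ?thesis using kl by (simp add: power_int_def)
  qed
  finally have pw: "(- b) powi k * (- b) powi l = (- b) * (- b) ^ N" .
  have val: "sym_quot h j (- complex_of_real b) = of_real ((1 + inverse a * inverse b) * (- b) powi j)" for j
    by (rule sym_quot_at_interior_pole[OF ab]) (rule h)
  \<comment> \<open>The mass \<open>r\<close> is the value for which the point contribution cancels the residue.\<close>
  have "r * ((1 + inverse a * inverse b) * (- b) powi k * ((1 + inverse a * inverse b) * (- b) powi l))
      = r * (1 + inverse a * inverse b)\<^sup>2 * ((- b) powi k * (- b) powi l)"
    by (simp add: power2_eq_square mult_ac)
  also have "\<dots> = 4 * pi * (1 - b\<^sup>2) / (1 + inverse a * b) * ((1 + inverse a * inverse b) * - b) * (- b) ^ N"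
  proof -
    have "P / (u * v) * u\<^sup>2 * (x * y) = P / v * (u * x) * y" if "u \<noteq> 0" for P u v x y :: real
      using that by (simp add: power2_eq_square)
    then show ?thesis unfolding pw r_def using pos(1) by simp
  qed
  also have "(1 + inverse a * inverse b) * - b = - (b + inverse a)"
    using ab by (simp add: field_simps)
  also have "4 * pi * (1 - b\<^sup>2) / (1 + inverse a * b) * - (b + inverse a) * (- b) ^ N = 4 * pi * A"
    unfolding A_def by (simp add: mult_ac)
  finally have "r *\<^sub>R (sym_quot h k (- of_real b) * sym_quot h l (- of_real b)) = complex_of_real (4 * pi * A)"
    unfolding val scaleR_conv_of_real of_real_mult[symmetric] by (simp only:)
  then have "has_bochner_integral (add_measure (circle_weight h)
        (scale_measure (ennreal r) (return punctured_borel (- of_real b))))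
      (\<lambda>\<xi>. sym_quot h k \<xi> * sym_quot h l \<xi>) (- complex_of_real (4 * pi * A) + of_real (4 * pi * A))"
    using point
    by (intro has_bochner_integral_add_measure circle)
       (simp_all add: circle_weight_def arclength_circle_def)
  then show "has_bochner_integral (add_measure (circle_weight h)
        (scale_measure (ennreal r) (return punctured_borel (- complex_of_real b))))
      (\<lambda>\<xi>. sym_quot h k \<xi> * sym_quot h l \<xi>) 0"
    by simp
qed

theorem theorem2p9:
  fixes h :: "complex \<Rightarrow> complex" and c :: "int \<Rightarrow> real" and n m :: int
  assumes "n \<le> m" and "c n \<noteq> 0" and "c m \<noteq> 0"
    and "\<And>\<xi>. \<xi> \<noteq> 0 \<Longrightarrow> h \<xi> = (\<Sum>i=n..m. of_real (c i) * \<xi> powi i)"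
  shows "((\<forall>z\<in>cball 0 1. \<not> is_pole (\<lambda>\<xi>. h \<xi> / h (inverse \<xi>)) z) \<longrightarrow>
            orthogonal_family {0..} (sym_quot h) (circle_weight h))
       \<and> ((\<forall>z\<in>- ball 0 1. \<not> is_pole (\<lambda>\<xi>. h \<xi> / h (inverse \<xi>)) z) \<and>
            \<not> is_pole_at_infinity (\<lambda>\<xi>. h \<xi> / h (inverse \<xi>)) \<longrightarrow>
            orthogonal_family {..0} (sym_quot h) (circle_weight h))
       \<and> (\<forall>a b :: real. 1 < a \<and> 0 < b \<and> b < 1 \<and>
            (\<forall>\<xi>. \<xi> \<noteq> 0 \<longrightarrow> h \<xi> =
               (1 - inverse (of_real a) * inverse \<xi>) * (1 + inverse (of_real b) * inverse \<xi>) * \<xi>) \<longrightarrow>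
            orthogonal_family {0..} (sym_quot h)
              (add_measure (circle_weight h)
                (scale_measure
                  (ennreal (4 * pi * (1 - b\<^sup>2) / ((1 + inverse a * inverse b) * (1 + inverse a * b))))
                  (return punctured_borel (- complex_of_real b)))))"
proof (intro conjI allI impI; (elim conjE)?)
  have h: "real_laurent_polynomial h"
    unfolding real_laurent_polynomial_def using assms by blast
  show "orthogonal_family {0..} (sym_quot h) (circle_weight h)"
    if "\<forall>z\<in>cball 0 1. \<not> is_pole (\<lambda>\<xi>. h \<xi> / h (inverse \<xi>)) z"
    using h that by (rule orthogonal_if_no_poles_in_disc)
  show "orthogonal_family {..0} (sym_quot h) (circle_weight h)"
    if "\<forall>z\<in>- ball 0 1. \<not> is_pole (\<lambda>\<xi>. h \<xi> / h (inverse \<xi>)) z"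
      "\<not> is_pole_at_infinity (\<lambda>\<xi>. h \<xi> / h (inverse \<xi>))"
    using h that by (rule orthogonal_if_no_poles_outside_disc)
  show "orthogonal_family {0..} (sym_quot h)
      (add_measure (circle_weight h)
        (scale_measure
          (ennreal (4 * pi * (1 - b\<^sup>2) / ((1 + inverse a * inverse b) * (1 + inverse a * b))))
          (return punctured_borel (- complex_of_real b))))"
    if "1 < a" "0 < b" "b < 1"
      "\<forall>\<xi>. \<xi> \<noteq> 0 \<longrightarrow> h \<xi> =
         (1 - inverse (of_real a) * inverse \<xi>) * (1 + inverse (of_real b) * inverse \<xi>) * \<xi>"
    for a b :: real
    using h that by (intro orthogonal_with_point_mass) simp_all
qed

end
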